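(* Let $d,M,N\ge 1$ be integers, let $\sigma:\mathbb{R}\to\mathbb{R}$ be the (twice differentiable) activation function, and let $\mathcal{J}^{\mathrm e}$ (the PINN loss) and $\mathcal{J}^{\mathrm e}_{\mathrm S}$ (the layer separation loss) be as defined in the context. Then for all network parameters $W_1\in\mathbb{R}^{M\times d}$, $W_2\in\mathbb{R}^{M\times M}$, $W_3\in\mathbb{R}^{1\times M}$, $b_1,b_2\in\mathbb{R}^{M}$, $b_3\in\mathbb{R}$ there exist auxiliary variables $a_1,a_2\in\mathbb{R}^{M\times N}$, $d_{1i},d_{2i}\in\mathbb{R}^{M\times N}$ and $q_i\in\mathbb{R}^{M\times N}$ ($i=1,\dots,d$) such that $$\mathcal{J}^{\mathrm e}_{\mathrm S}\le \mathcal{J}^{\mathrm e}.$$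
   Context: Conventions: $*$ is the entrywise (Hadamard) product; $\sigma,\sigma',\sigma''$ act entrywise on matrices; $\mathbf 1$ is the all-one column vector of length $N$; $\|\cdot\|_{\mathrm F}$ is the Frobenius norm (Euclidean norm for vectors); $|v|_\infty$ is the maximum absolute value of the entries of a vector $v$; $A(:,i)$ is the $i$-th column of $A$ and $A[n]$ the $n$-th column of an $M\times N$ matrix $A$; for a diagonal $N\times N$ matrix $\mathcal D$, $\|A\|_{\mathcal D}=\big(\sum_{n=1}^N \mathcal D(n,n)^2\|A[n]\|_2^2\big)^{1/2}$; $I$ is the identity matrix. Data: $\Omega=\{x\in\mathbb{R}^d:\|x\|_2\le1\}$; $c$ is a continuous real function with $c(x)>\delta$ on $\Omega$ for some $\delta>0$ (the first partial derivatives of $c$ occurring below are understood to exist); $f:\Omega\to\mathbb{R}$; $x_1,\dots,x_N\in\Omega$; $y_n=f(x_n)$; $X=[x_1\cdots x_N]\in\mathbb{R}^{d\times N}$, with $i$-th row $X(i,:)$; $Y=[y_1\cdots y_N]\in\mathbb{R}^{1\times N}$; $\hat X=[\|x_1\|_2^2\cdots\|x_N\|_2^2]$, and $\hat X-1$ subtracts $1$ from each entry. $c(X)$ and $\partial_{x_i}c(X)$ are the row vectors of values $c(x_n)$ and $(\partial_{x_i}c)(x_n)$. PINN loss: with $\phi(x)=W_3\sigma(W_2\sigma(W_1x+b_1)+b_2)+b_3$ and $\psi_{\mathrm e}(x)=(\|x\|_2^2-1)\phi(x)$, $$\mathcal{J}^{\mathrm e}=\frac1N\sum_{n=1}^N\Big|\big[\nabla\cdot(c\nabla\psi_{\mathrm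 e})\big](x_n)-y_n\Big|^2 .$$ Coefficient row vectors, for $i=1,\dots,d$: $K^{\mathrm e}=2\big(d\,c(X)+\sum_{i=1}^dX(i,:)*\partial_{x_i}c(X)\big)$, $\hat K^{\mathrm e}=c(X)*(\hat X-1)$, $K^{\mathrm e}_i=4X(i,:)*c(X)+\partial_{x_i}c(X)*(\hat X-1)$. Layer separation loss: $$\mathcal{J}^{\mathrm e}_{\mathrm S}=\frac1N\Big[\Big\|K^{\mathrm e}*(W_3\sigma(a_2)+b_3\mathbf 1^\top)+\sum_{i=1}^dK^{\mathrm e}_i*(W_3(\sigma'(a_2)*d_{2i}))+\hat K^{\mathrm e}*\sum_{i=1}^dW_3(\sigma''(a_2)*d_{2i}*d_{2i}+\sigma'(a_2)*q_i)-Y\Big\|_{\mathrm F}^2$$ $$+\omega_{a_1}^1\|W_1X+b_1\mathbf 1^\top-a_1\|^2_{\mathcal D_{a_1}^1}+\sum_{k=2}^3\sum_{i=1}^d\omega_{a_1}^{ki}\|W_1X+b_1\mathbf 1^\top-a_1\|^2_{\mathcal D_{a_1}^{ki}}$$ $$+\omega_{a_2}^1\|W_2\sigma(a_1)+b_2\mathbf 1^\top-a_2\|^2_{\mathcal D_{a_2}^1}+\sum_{i=1}^d\omega_{a_2}^{2i}\|W_2\sigma(a_1)+b_2\mathbf 1^\top-a_2\|^2_{\mathcal D_{a_2}^{2i}}$$ $$+\sum_{k=1}^2\sum_{i=1}^d\Big(\omega_{d_{1i}}^k\|W_1(:,i)\mathbf 1^\top-d_{1i}\|^2_{\mathcal D_{d_{1i}}^k}+\omega_{d_{2i}}^k\|W_2(\sigma'(a_1)*d_{1i})-d_{2i}\|^2_{\mathcal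 D_{d_{2i}}^k}\Big)+\sum_{i=1}^d\omega_{q_i}\|W_2(\sigma''(a_1)*d_{1i}*d_{1i})-q_i\|_{\mathrm F}^2\Big],$$ with weights ($i=1,\dots,d$): $\omega_{a_1}^1=\omega_{d_{1i}}^2=\|W_3\|_{\mathrm F}^2\|W_2\|_{\mathrm F}^2$; $\omega_{a_1}^{2i}=\omega_{a_2}^{2i}=\omega_{a_1}^1\|W_1(:,i)\|_{\mathrm F}^2$; $\omega_{a_1}^{3i}=\omega_{a_1}^{2i}\|W_2\|_{\mathrm F}^2$; $\omega_{a_2}^1=\omega_{d_{2i}}^1=\|W_3\|_{\mathrm F}^2$; $\omega_{d_{1i}}^1=|\hat K^{\mathrm e}|_\infty^2(\omega_{a_1}^{2i}+\omega_{a_1}^{3i})$; $\omega_{d_{2i}}^2=|\hat K^{\mathrm e}|_\infty^2\omega_{a_1}^{2i}$; $\omega_{q_i}=|\hat K^{\mathrm e}|_\infty^2\omega_{a_2}^1$; and diagonal $N\times N$ matrices with diagonal entries ($i=1,\dots,d$, $n=1,\dots,N$): $\mathcal D_{a_2}^1(n,n)=\big(|K^{\mathrm e}|_\infty^2+\sum_{i=1}^d(|K_i^{\mathrm e}|_\infty^2\|d_{2i}[n]\|_{\mathrm F}^2+|\hat K^{\mathrm e}|_\infty^2\|q_i[n]\|_{\mathrm F}^2)\big)^{1/2}$; $\mathcal D_{a_1}^{2i}(n,n)=|\hat K^{\mathrm e}|_\infty\|d_{1i}[n]\|_{\mathrm F}$; $\mathcal D_{a_2}^{2i}(n,n)=|\hat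 K^{\mathrm e}|_\infty\|d_{2i}[n]\|_{\mathrm F}$; $\mathcal D_{a_1}^{3i}(n,n)=\big(\mathcal D_{a_1}^{2i}(n,n)^2+\mathcal D_{a_2}^{2i}(n,n)^2\big)^{1/2}$; $\mathcal D_{a_1}^1(n,n)=\big(\mathcal D_{a_2}^1(n,n)^2+\sum_{i=1}^d(|K_i^{\mathrm e}|_\infty^2\|d_{1i}[n]\|_{\mathrm F}^2+\mathcal D_{a_1}^{2i}(n,n)^2\|d_{2i}[n]\|_{\mathrm F}^2)\big)^{1/2}$; $\mathcal D_{d_{1i}}^1=\mathcal D_{d_{2i}}^2=I$; $\mathcal D_{d_{1i}}^2(n,n)=\big(|K_i^{\mathrm e}|_\infty^2+\mathcal D_{a_1}^{3i}(n,n)^2\big)^{1/2}$; $\mathcal D_{d_{2i}}^1(n,n)=\big(|K_i^{\mathrm e}|_\infty^2+\mathcal D_{a_2}^{2i}(n,n)^2\big)^{1/2}$. *)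

theory Defs
  imports "HOL-Analysis.Analysis"
begin

text \<open>
  An \<open>M \<times> N\<close> matrix is an element of \<open>real ^ 'n ^ 'm\<close> (row type last), and a row vector is a
  matrix of type \<open>real ^ 'n ^ 1\<close>. For these types the library operations mean the following:
  \<open>*\<close> is the entrywise (Hadamard) product, \<open>**\<close> the matrix product, \<open>1\<close> the matrix all of whose
  entries are one (the identity matrix is \<open>mat 1\<close>), \<open>norm\<close> the Frobenius norm, \<open>infnorm\<close> the
  maximum absolute value of the entries, and \<open>map_matrix s\<close> the entrywise application of \<open>s\<close>.
\<close>

definition partial_deriv :: "'d::finite \<Rightarrow> (real^'d \<Rightarrow> real) \<Rightarrow> real^'d \<Rightarrow> real" where
  "partial_deriv i g x = deriv (\<lambda>t. g (x + t *\<^sub>R axis i 1)) 0"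

definition gradient :: "(real^'d::finite \<Rightarrow> real) \<Rightarrow> real^'d \<Rightarrow> real^'d" where
  "gradient g x = (\<chi> i. partial_deriv i g x)"

definition divergence :: "(real^'d::finite \<Rightarrow> real^'d) \<Rightarrow> real^'d \<Rightarrow> real" where
  "divergence F x = (\<Sum>i\<in>UNIV. partial_deriv i (\<lambda>y. F y $ i) x)"

definition map_vec :: "('a \<Rightarrow> 'b) \<Rightarrow> 'a^'n::finite \<Rightarrow> 'b^'n" where
  "map_vec s v = (\<chi> i. s (v $ i))"

definition diag_matrix :: "('n::finite \<Rightarrow> real) \<Rightarrow> real^'n^'n" where
  "diag_matrix f = (\<chi> n k. if n = k then f n else 0)"

definition norm_diag :: "real^'n::finite^'n \<Rightarrow> real^'n^'m::finite \<Rightarrow> real" where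
  "norm_diag D A = sqrt (\<Sum>n\<in>UNIV. (D $ n $ n)\<^sup>2 * (norm (column n A))\<^sup>2)"

text \<open>The all-one column vector is \<open>1\<close>, its transpose is \<open>1 :: real^'n^1\<close>; this is \<open>v 1\<^sup>T\<close>.\<close>

definition repeat_col :: "real^'m::finite \<Rightarrow> real^'n::finite^'m" where
  "repeat_col v = (columnvector v :: real^1^'m) ** (1 :: real^'n^1)"

definition phi :: "(real \<Rightarrow> real) \<Rightarrow> real^'d::finite^'m::finite \<Rightarrow> real^'m^'m \<Rightarrow> real^'m^1 \<Rightarrow>
    real^'m \<Rightarrow> real^'m \<Rightarrow> real \<Rightarrow> real^'d \<Rightarrow> real" where
  "phi \<sigma> W1 W2 W3 b1 b2 b3 x =
     (W3 *v map_vec \<sigma> (W2 *v map_vec \<sigma> (W1 *v x + b1) + b2)) $ 1 + b3"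

definition psi_e :: "(real \<Rightarrow> real) \<Rightarrow> real^'d::finite^'m::finite \<Rightarrow> real^'m^'m \<Rightarrow> real^'m^1 \<Rightarrow>
    real^'m \<Rightarrow> real^'m \<Rightarrow> real \<Rightarrow> real^'d \<Rightarrow> real" where
  "psi_e \<sigma> W1 W2 W3 b1 b2 b3 x = ((norm x)\<^sup>2 - 1) * phi \<sigma> W1 W2 W3 b1 b2 b3 x"

definition J_e :: "(real^'d::finite \<Rightarrow> real) \<Rightarrow> ('n::finite \<Rightarrow> real^'d) \<Rightarrow> (real^'d \<Rightarrow> real) \<Rightarrow>
    (real \<Rightarrow> real) \<Rightarrow> real^'d^'m::finite \<Rightarrow> real^'m^'m \<Rightarrow> real^'m^1 \<Rightarrow>
    real^'m \<Rightarrow> real^'m \<Rightarrow> real \<Rightarrow> real" where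
  "J_e c x f \<sigma> W1 W2 W3 b1 b2 b3 =
     1 / real CARD('n) *
       (\<Sum>n\<in>UNIV. \<bar>divergence (\<lambda>z. c z *\<^sub>R gradient (psi_e \<sigma> W1 W2 W3 b1 b2 b3) z) (x n) - f (x n)\<bar>\<^sup>2)"

context
  fixes c :: "real^'d::finite \<Rightarrow> real" and x :: "'n::finite \<Rightarrow> real^'d"
begin

definition Xmat :: "real^'n^'d" where
  "Xmat = (\<chi> i n. x n $ i)"

definition Xrow :: "'d \<Rightarrow> real^'n^1" where
  "Xrow i = rowvector (row i Xmat)"

definition Xhat :: "real^'n^1" where
  "Xhat = (\<chi> _ n. (norm (x n))\<^sup>2)"

definition eval_row :: "(real^'d \<Rightarrow> real) \<Rightarrow> real^'n^1" where
  "eval_row g = (\<chi> _ n. g (x n))"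

definition K_e :: "real^'n^1" where
  "K_e = 2 *\<^sub>R (real CARD('d) *\<^sub>R eval_row c + (\<Sum>i\<in>UNIV. Xrow i * eval_row (partial_deriv i c)))"

definition Khat_e :: "real^'n^1" where
  "Khat_e = eval_row c * (Xhat - 1)"

definition Ki_e :: "'d \<Rightarrow> real^'n^1" where
  "Ki_e i = 4 *\<^sub>R (Xrow i * eval_row c) + eval_row (partial_deriv i c) * (Xhat - 1)"

text \<open>
  Weights and diagonal matrices. In the names below a trailing \<open>_k\<close> is the superscript \<open>k\<close>, and
  an argument \<open>i\<close> is the index \<open>i\<close>; e.g. \<open>D_a1_3 i\<close> is the matrix \<open>D\<close> with subscript \<open>a\<^sub>1\<close> and
  superscript \<open>3i\<close>.
\<close>

definition w_a1_1 :: "real^'m::finite^'m \<Rightarrow> real^'m^1 \<Rightarrow> real" where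
  "w_a1_1 W2 W3 = (norm W3)\<^sup>2 * (norm W2)\<^sup>2"

definition w_d1_2 :: "real^'m::finite^'m \<Rightarrow> real^'m^1 \<Rightarrow> 'd \<Rightarrow> real" where
  "w_d1_2 W2 W3 i = (norm W3)\<^sup>2 * (norm W2)\<^sup>2"

definition w_a1_2 :: "real^'d^'m::finite \<Rightarrow> real^'m^'m \<Rightarrow> real^'m^1 \<Rightarrow> 'd \<Rightarrow> real" where
  "w_a1_2 W1 W2 W3 i = w_a1_1 W2 W3 * (norm (column i W1))\<^sup>2"

definition w_a2_2 :: "real^'d^'m::finite \<Rightarrow> real^'m^'m \<Rightarrow> real^'m^1 \<Rightarrow> 'd \<Rightarrow> real" where
  "w_a2_2 W1 W2 W3 i = w_a1_1 W2 W3 * (norm (column i W1))\<^sup>2"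

definition w_a1_3 :: "real^'d^'m::finite \<Rightarrow> real^'m^'m \<Rightarrow> real^'m^1 \<Rightarrow> 'd \<Rightarrow> real" where
  "w_a1_3 W1 W2 W3 i = w_a1_2 W1 W2 W3 i * (norm W2)\<^sup>2"

definition w_a2_1 :: "real^'m::finite^1 \<Rightarrow> real" where
  "w_a2_1 W3 = (norm W3)\<^sup>2"

definition w_d2_1 :: "real^'m::finite^1 \<Rightarrow> 'd \<Rightarrow> real" where
  "w_d2_1 W3 i = (norm W3)\<^sup>2"

definition w_d1_1 :: "real^'d^'m::finite \<Rightarrow> real^'m^'m \<Rightarrow> real^'m^1 \<Rightarrow> 'd \<Rightarrow> real" where
  "w_d1_1 W1 W2 W3 i = (infnorm Khat_e)\<^sup>2 * (w_a1_2 W1 W2 W3 i + w_a1_3 W1 W2 W3 i)"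

definition w_d2_2 :: "real^'d^'m::finite \<Rightarrow> real^'m^'m \<Rightarrow> real^'m^1 \<Rightarrow> 'd \<Rightarrow> real" where
  "w_d2_2 W1 W2 W3 i = (infnorm Khat_e)\<^sup>2 * w_a1_2 W1 W2 W3 i"

definition w_q :: "real^'m::finite^1 \<Rightarrow> 'd \<Rightarrow> real" where
  "w_q W3 i = (infnorm Khat_e)\<^sup>2 * w_a2_1 W3"

definition D_a2_1 :: "('d \<Rightarrow> real^'n^'m::finite) \<Rightarrow> ('d \<Rightarrow> real^'n^'m) \<Rightarrow> real^'n^'n" where
  "D_a2_1 d2 q = diag_matrix (\<lambda>n. sqrt ((infnorm K_e)\<^sup>2 +
     (\<Sum>i\<in>UNIV. (infnorm (Ki_e i))\<^sup>2 * (norm (column n (d2 i)))\<^sup>2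
                + (infnorm Khat_e)\<^sup>2 * (norm (column n (q i)))\<^sup>2)))"

definition D_a1_2 :: "('d \<Rightarrow> real^'n^'m::finite) \<Rightarrow> 'd \<Rightarrow> real^'n^'n" where
  "D_a1_2 d1 i = diag_matrix (\<lambda>n. infnorm Khat_e * norm (column n (d1 i)))"

definition D_a2_2 :: "('d \<Rightarrow> real^'n^'m::finite) \<Rightarrow> 'd \<Rightarrow> real^'n^'n" where
  "D_a2_2 d2 i = diag_matrix (\<lambda>n. infnorm Khat_e * norm (column n (d2 i)))"

definition D_a1_3 :: "('d \<Rightarrow> real^'n^'m::finite) \<Rightarrow> ('d \<Rightarrow> real^'n^'m) \<Rightarrow> 'd \<Rightarrow> real^'n^'n" where
  "D_a1_3 d1 d2 i = diag_matrix (\<lambda>n. sqrt ((D_a1_2 d1 i $ n $ n)\<^sup>2 + (D_a2_2 d2 i $ n $ n)\<^sup>2))"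

definition D_a1_1 :: "('d \<Rightarrow> real^'n^'m::finite) \<Rightarrow> ('d \<Rightarrow> real^'n^'m) \<Rightarrow> ('d \<Rightarrow> real^'n^'m) \<Rightarrow> real^'n^'n" where
  "D_a1_1 d1 d2 q = diag_matrix (\<lambda>n. sqrt ((D_a2_1 d2 q $ n $ n)\<^sup>2 +
     (\<Sum>i\<in>UNIV. (infnorm (Ki_e i))\<^sup>2 * (norm (column n (d1 i)))\<^sup>2
                + (D_a1_2 d1 i $ n $ n)\<^sup>2 * (norm (column n (d2 i)))\<^sup>2)))"

definition D_d1_1 :: "'d \<Rightarrow> real^'n^'n" where
  "D_d1_1 i = mat 1"

definition D_d2_2 :: "'d \<Rightarrow> real^'n^'n" where
  "D_d2_2 i = mat 1"

definition D_d1_2 :: "('d \<Rightarrow> real^'n^'m::finite) \<Rightarrow> ('d \<Rightarrow> real^'n^'m) \<Rightarrow> 'd \<Rightarrow> real^'n^'n" where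
  "D_d1_2 d1 d2 i = diag_matrix (\<lambda>n. sqrt ((infnorm (Ki_e i))\<^sup>2 + (D_a1_3 d1 d2 i $ n $ n)\<^sup>2))"

definition D_d2_1 :: "('d \<Rightarrow> real^'n^'m::finite) \<Rightarrow> 'd \<Rightarrow> real^'n^'n" where
  "D_d2_1 d2 i = diag_matrix (\<lambda>n. sqrt ((infnorm (Ki_e i))\<^sup>2 + (D_a2_2 d2 i $ n $ n)\<^sup>2))"

text \<open>The sums over \<open>k\<close> in the penalty terms are written out. \<open>\<sigma>'\<close>, \<open>\<sigma>''\<close> are \<open>deriv \<sigma>\<close>, \<open>deriv (deriv \<sigma>)\<close>.\<close>

definition J_S_e :: "(real^'d \<Rightarrow> real) \<Rightarrow> (real \<Rightarrow> real) \<Rightarrow>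
    real^'d^'m::finite \<Rightarrow> real^'m^'m \<Rightarrow> real^'m^1 \<Rightarrow> real^'m \<Rightarrow> real^'m \<Rightarrow> real \<Rightarrow>
    real^'n^'m \<Rightarrow> real^'n^'m \<Rightarrow> ('d \<Rightarrow> real^'n^'m) \<Rightarrow> ('d \<Rightarrow> real^'n^'m) \<Rightarrow> ('d \<Rightarrow> real^'n^'m) \<Rightarrow> real" where
  "J_S_e f \<sigma> W1 W2 W3 b1 b2 b3 a1 a2 d1 d2 q =
    (let \<sigma>' = deriv \<sigma>; \<sigma>'' = deriv (deriv \<sigma>);
         res_a1 = W1 ** Xmat + repeat_col b1 - a1;
         res_a2 = W2 ** map_matrix \<sigma> a1 + repeat_col b2 - a2;
         res_d1 = (\<lambda>i. repeat_col (column i W1) - d1 i);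
         res_d2 = (\<lambda>i. W2 ** (map_matrix \<sigma>' a1 * d1 i) - d2 i);
         res_q = (\<lambda>i. W2 ** (map_matrix \<sigma>'' a1 * d1 i * d1 i) - q i)
     in 1 / real CARD('n) *
       ((norm (K_e * (W3 ** map_matrix \<sigma> a2 + b3 *\<^sub>R 1)
             + (\<Sum>i\<in>UNIV. Ki_e i * (W3 ** (map_matrix \<sigma>' a2 * d2 i)))
             + Khat_e * (\<Sum>i\<in>UNIV. W3 ** (map_matrix \<sigma>'' a2 * d2 i * d2 i + map_matrix \<sigma>' a2 * q i))
             - eval_row f))\<^sup>2
        + w_a1_1 W2 W3 * (norm_diag (D_a1_1 d1 d2 q) res_a1)\<^sup>2
        + ((\<Sum>i\<in>UNIV. w_a1_2 W1 W2 W3 i * (norm_diag (D_a1_2 d1 i) res_a1)\<^sup>2)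
         + (\<Sum>i\<in>UNIV. w_a1_3 W1 W2 W3 i * (norm_diag (D_a1_3 d1 d2 i) res_a1)\<^sup>2))
        + w_a2_1 W3 * (norm_diag (D_a2_1 d2 q) res_a2)\<^sup>2
        + (\<Sum>i\<in>UNIV. w_a2_2 W1 W2 W3 i * (norm_diag (D_a2_2 d2 i) res_a2)\<^sup>2)
        + ((\<Sum>i\<in>UNIV. w_d1_1 W1 W2 W3 i * (norm_diag (D_d1_1 i) (res_d1 i))\<^sup>2
                      + w_d2_1 W3 i * (norm_diag (D_d2_1 d2 i) (res_d2 i))\<^sup>2)
         + (\<Sum>i\<in>UNIV. w_d1_2 W2 W3 i * (norm_diag (D_d1_2 d1 d2 i) (res_d1 i))\<^sup>2
                      + w_d2_2 W1 W2 W3 i * (norm_diag (D_d2_2 i) (res_d2 i))\<^sup>2))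
        + (\<Sum>i\<in>UNIV. w_q W3 i * (norm (res_q i))\<^sup>2)))"

end

end

theory Submission
  imports Defs
begin

text \<open>
  With the auxiliary variables equal to the exact quantities of the forward pass (the
  pre-activations and their first and second partial derivatives at the sample points) all penalty
  residuals vanish, and expanding \<open>\<nabla> \<cdot> (c \<nabla> \<psi>)\<close> for \<open>\<psi> x = (\<parallel>x\<parallel>\<^sup>2 - 1) \<phi> x\<close> by the product
  rule shows that the remaining term is the PINN loss, so that equality holds.
\<close>

section \<open>Calculus of partial derivatives along coordinate lines\<close>

text \<open>A relation records existence together with the value, which
  \<open>partial_deriv\<close>, built on \<open>deriv\<close>, does not. As an abbreviation it
  leaves the library rules for \<open>has_real_derivative\<close> directly applicable.\<close>

abbreviation has_partial ::
    "'d::finite \<Rightarrow> (real^'d \<Rightarrow> real) \<Rightarrow> real \<Rightarrow> real^'d \<Rightarrow> bool" where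
  "has_partial i g D x \<equiv> ((\<lambda>t. g (x + t *\<^sub>R axis i 1)) has_real_derivative D) (at 0)"

lemma partial_deriv_eqI: "has_partial i g D x \<Longrightarrow> partial_deriv i g x = D"
  unfolding partial_deriv_def by (rule DERIV_imp_deriv)

lemma has_partial_mult:
  assumes "has_partial i g D x" "has_partial i h E x"
  shows "has_partial i (\<lambda>y. g y * h y) (D * h x + g x * E) x"
  using DERIV_mult[OF assms] by (simp add: mult.commute add.commute)

lemma has_partial_add:
  assumes "has_partial i g D x" "has_partial i h E x"
  shows "has_partial i (\<lambda>y. g y + h y) (D + E) x"
  using DERIV_add[OF assms] .

lemma has_partial_component: "has_partial i (\<lambda>y. y $ i) 1 x"
  by (auto intro!: derivative_eq_intros simp: axis_def)

text \<open>Along the line through \<open>x\<close> in a unit direction the squared norm is a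
  quadratic polynomial in \<open>t\<close> with linear coefficient \<open>2 * x $ i\<close>.\<close>

lemma has_partial_norm_square: "has_partial i (\<lambda>y. (norm y)\<^sup>2 - 1) (2 * x $ i) x"
proof -
  have "(norm (x + t *\<^sub>R axis i 1))\<^sup>2 - 1 = (norm x)\<^sup>2 + 2 * t * x $ i + t\<^sup>2 - 1" for t
    unfolding power2_norm_eq_inner
    by (simp add: inner_add_left inner_add_right inner_axis inner_axis' power2_eq_square
        algebra_simps)
  then show ?thesis
    by (auto intro!: derivative_eq_intros)
qed

lemma has_partial_linear:
  fixes W :: "real^'k::finite^'m::finite"
  assumes "\<And>k. has_partial i (\<lambda>y. h y $ k) (h' $ k) x"
  shows "has_partial i (\<lambda>y. (W *v h y) $ m) ((W *v h') $ m) x"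
  unfolding matrix_vector_mult_def vec_lambda_beta
  by (intro DERIV_sum DERIV_cmult assms)

lemma has_partial_map_vec:
  assumes "\<And>t. s differentiable (at t)"
    and "has_partial i (\<lambda>y. h y $ k) (h' $ k) x"
  shows "has_partial i (\<lambda>y. map_vec s (h y) $ k) ((map_vec (deriv s) (h x) * h') $ k) x"
proof -
  \<comment> \<open>The base point is written as the inner function at \<open>t = 0\<close>, the
    form that the chain rule \<open>DERIV_chain2\<close> expects.\<close>
  have "(s has_real_derivative deriv s (h (x + 0 *\<^sub>R axis i 1) $ k)) (at (h (x + 0 *\<^sub>R axis i 1) $ k))"
    using assms(1) by (simp add: DERIV_deriv_iff_real_differentiable)
  from DERIV_chain2[OF this assms(2)] show ?thesis
    by (simp add: map_vec_def)
qed

lemma has_partial_affine: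
  fixes W1 :: "real^'d::finite^'m::finite"
  shows "has_partial i (\<lambda>y. (W1 *v y + b1) $ m) (column i W1 $ m) x"
  by (auto intro!: derivative_eq_intros
      simp: matrix_vector_right_distrib matrix_vector_mult_scaleR matrix_vector_mult_basis)

section \<open>Closed forms for the derivatives of the network\<close>

context
  fixes \<sigma> :: "real \<Rightarrow> real" and W1 :: "real^'d::finite^'m::finite" and W2 :: "real^'m^'m"
    and W3 :: "real^'m^1" and b1 b2 :: "real^'m" and b3 :: real
begin

definition layer1 :: "real^'d \<Rightarrow> real^'m" where
  "layer1 y = W1 *v y + b1"

definition layer2 :: "real^'d \<Rightarrow> real^'m" where
  "layer2 y = W2 *v map_vec \<sigma> (layer1 y) + b2"

text \<open>An explicit chain-rule formula instead of a \<open>partial_deriv\<close> term: it has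
  the shape of the penalty term for \<open>d2\<close>, so that residual cancels by
  unfolding.\<close>

definition layer2_deriv :: "'d \<Rightarrow> real^'d \<Rightarrow> real^'m" where
  "layer2_deriv i y = W2 *v (map_vec (deriv \<sigma>) (layer1 y) * column i W1)"

text \<open>Only a \<open>deriv (deriv \<sigma>)\<close> term occurs: the first layer is affine, so
  its derivative \<open>column i W1\<close> is constant in \<open>y\<close>.\<close>

definition layer2_deriv2 :: "'d \<Rightarrow> real^'d \<Rightarrow> real^'m" where
  "layer2_deriv2 i y =
     W2 *v (map_vec (deriv (deriv \<sigma>)) (layer1 y) * column i W1 * column i W1)"

definition phi_deriv :: "'d \<Rightarrow> real^'d \<Rightarrow> real" where
  "phi_deriv i y = (W3 *v (map_vec (deriv \<sigma>) (layer2 y) * layer2_deriv i y)) $ 1"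

definition phi_deriv2 :: "'d \<Rightarrow> real^'d \<Rightarrow> real" where
  "phi_deriv2 i y =
     (W3 *v (map_vec (deriv (deriv \<sigma>)) (layer2 y) * layer2_deriv i y * layer2_deriv i y
       + map_vec (deriv \<sigma>) (layer2 y) * layer2_deriv2 i y)) $ 1"

lemma phi_eq_layer2: "phi \<sigma> W1 W2 W3 b1 b2 b3 y = (W3 *v map_vec \<sigma> (layer2 y)) $ 1 + b3"
  by (simp add: phi_def layer2_def layer1_def)

lemma has_partial_layer1: "has_partial i (\<lambda>y. layer1 y $ m) (column i W1 $ m) x"
  unfolding layer1_def by (rule has_partial_affine)

context
  assumes \<sigma>_differentiable: "\<And>t. \<sigma> differentiable (at t)"
    and \<sigma>_twice_differentiable: "\<And>t. deriv \<sigma> differentiable (at t)"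
begin

lemma has_partial_layer2: "has_partial i (\<lambda>y. layer2 y $ m) (layer2_deriv i x $ m) x"
proof -
  have "has_partial i (\<lambda>y. (W2 *v map_vec \<sigma> (layer1 y)) $ m) (layer2_deriv i x $ m) x"
    unfolding layer2_deriv_def
    by (intro has_partial_linear has_partial_map_vec \<sigma>_differentiable has_partial_layer1)
  from DERIV_add[OF this DERIV_const[of "b2 $ m"]] show ?thesis
    by (simp add: layer2_def)
qed

lemma has_partial_layer2_deriv:
  "has_partial i (\<lambda>y. layer2_deriv i y $ m) (layer2_deriv2 i x $ m) x"
  unfolding layer2_deriv_def layer2_deriv2_def
proof (rule has_partial_linear)
  fix k
  have "has_partial i (\<lambda>y. map_vec (deriv \<sigma>) (layer1 y) $ k)
      ((map_vec (deriv (deriv \<sigma>)) (layer1 x) * column i W1) $ k) x"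
    by (intro has_partial_map_vec \<sigma>_twice_differentiable has_partial_layer1)
  from DERIV_cmult_right[OF this, of "column i W1 $ k"]
  show "has_partial i (\<lambda>y. (map_vec (deriv \<sigma>) (layer1 y) * column i W1) $ k)
      ((map_vec (deriv (deriv \<sigma>)) (layer1 x) * column i W1 * column i W1) $ k) x"
    by simp
qed

lemma has_partial_phi: "has_partial i (phi \<sigma> W1 W2 W3 b1 b2 b3) (phi_deriv i x) x"
proof -
  have "has_partial i (\<lambda>y. (W3 *v map_vec \<sigma> (layer2 y)) $ 1) (phi_deriv i x) x"
    unfolding phi_deriv_def
    by (intro has_partial_linear has_partial_map_vec \<sigma>_differentiable has_partial_layer2)
  from DERIV_add[OF this DERIV_const[of b3]] show ?thesis
    by (simp add: phi_eq_layer2)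
qed

text \<open>Here both Hadamard factors depend on the point, so the product rule yields the two
  summands of \<open>phi_deriv2\<close>.\<close>

lemma has_partial_phi_deriv: "has_partial i (phi_deriv i) (phi_deriv2 i x) x"
  unfolding phi_deriv_def phi_deriv2_def
proof (rule has_partial_linear)
  fix k
  have "has_partial i (\<lambda>y. map_vec (deriv \<sigma>) (layer2 y) $ k)
      ((map_vec (deriv (deriv \<sigma>)) (layer2 x) * layer2_deriv i x) $ k) x"
    by (intro has_partial_map_vec \<sigma>_twice_differentiable has_partial_layer2)
  from has_partial_mult[OF this has_partial_layer2_deriv]
  show "has_partial i (\<lambda>y. (map_vec (deriv \<sigma>) (layer2 y) * layer2_deriv i y) $ k)
      ((map_vec (deriv (deriv \<sigma>)) (layer2 x) * layer2_deriv i x * layer2_deriv i x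
        + map_vec (deriv \<sigma>) (layer2 x) * layer2_deriv2 i x) $ k) x"
    by simp
qed

text \<open>Valid at every \<open>y\<close>, hence usable as a rewrite rule under a further
  derivative.\<close>

lemma partial_deriv_psi_e:
  "partial_deriv i (psi_e \<sigma> W1 W2 W3 b1 b2 b3) y =
     2 * y $ i * phi \<sigma> W1 W2 W3 b1 b2 b3 y + ((norm y)\<^sup>2 - 1) * phi_deriv i y"
proof (rule partial_deriv_eqI)
  show "has_partial i (psi_e \<sigma> W1 W2 W3 b1 b2 b3)
     (2 * y $ i * phi \<sigma> W1 W2 W3 b1 b2 b3 y + ((norm y)\<^sup>2 - 1) * phi_deriv i y) y"
    unfolding psi_e_def by (rule has_partial_mult[OF has_partial_norm_square has_partial_phi])
qed

text \<open>The factor 4 collects two equal cross terms \<open>2 * x $ i * phi_deriv i x\<close>,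
  one from each summand of the first derivative.\<close>

lemma has_partial_partial_deriv_psi_e:
  "has_partial i (partial_deriv i (psi_e \<sigma> W1 W2 W3 b1 b2 b3))
     (2 * phi \<sigma> W1 W2 W3 b1 b2 b3 x + 4 * x $ i * phi_deriv i x
       + ((norm x)\<^sup>2 - 1) * phi_deriv2 i x) x"
proof -
  have "has_partial i (\<lambda>y. 2 * y $ i) 2 x"
    using DERIV_cmult[OF has_partial_component, of 2] by simp
  from has_partial_add[OF has_partial_mult[OF this has_partial_phi]
      has_partial_mult[OF has_partial_norm_square has_partial_phi_deriv]]
  show ?thesis
    unfolding partial_deriv_psi_e by (simp add: algebra_simps)
qed

text \<open>The product rule is applied in each coordinate and the result is grouped by
  \<open>phi\<close>, \<open>phi_deriv\<close> and \<open>phi_deriv2\<close>; at a sample point the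
  coefficients are the entries of \<open>K_e\<close>, \<open>Ki_e\<close> and
  \<open>Khat_e\<close>.\<close>

lemma divergence_flux_psi_e:
  assumes "\<And>i. (\<lambda>t. c (x + t *\<^sub>R axis i 1)) differentiable (at (0::real))"
  shows "divergence (\<lambda>z. c z *\<^sub>R gradient (psi_e \<sigma> W1 W2 W3 b1 b2 b3) z) x =
     2 * (real CARD('d) * c x + (\<Sum>i\<in>UNIV. x $ i * partial_deriv i c x))
       * phi \<sigma> W1 W2 W3 b1 b2 b3 x
     + (\<Sum>i\<in>UNIV. (4 * (x $ i * c x) + partial_deriv i c x * ((norm x)\<^sup>2 - 1)) * phi_deriv i x)
     + c x * ((norm x)\<^sup>2 - 1) * (\<Sum>i\<in>UNIV. phi_deriv2 i x)"
proof -
  have c: "has_partial i c (partial_deriv i c x) x" for i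
    using assms unfolding partial_deriv_def by (simp add: DERIV_deriv_iff_real_differentiable)
  have "partial_deriv i (\<lambda>y. (c y *\<^sub>R gradient (psi_e \<sigma> W1 W2 W3 b1 b2 b3) y) $ i) x =
      2 * c x * phi \<sigma> W1 W2 W3 b1 b2 b3 x
      + 2 * (x $ i * partial_deriv i c x) * phi \<sigma> W1 W2 W3 b1 b2 b3 x
      + (4 * (x $ i * c x) + partial_deriv i c x * ((norm x)\<^sup>2 - 1)) * phi_deriv i x
      + c x * ((norm x)\<^sup>2 - 1) * phi_deriv2 i x" for i
    using has_partial_mult[OF c has_partial_partial_deriv_psi_e, THEN partial_deriv_eqI, of i]
    by (simp add: gradient_def partial_deriv_psi_e algebra_simps)
  then show ?thesis
    unfolding divergence_def
    \<comment> \<open>Factors independent of \<open>i\<close> leave the sums; the summand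
      \<open>2 * c x * phi\<close>, the same for all \<open>i\<close>, produces
      \<open>CARD('d)\<close>.\<close>
    by (simp only: sum.distrib flip: sum_distrib_left sum_distrib_right)
      (simp add: algebra_simps)
qed

end

end

section \<open>Matrices read column by column, one column per sample\<close>

lemma matrix_mult_nth: "(A ** B) $ m $ n = (A *v column n B) $ m"
  by (simp add: matrix_matrix_mult_def matrix_vector_mult_def column_def)

lemma column_times: "column n (A * B) = column n A * column n B"
  by (simp add: column_def vec_eq_iff)

lemma column_plus: "column n (A + B) = column n A + column n B"
  by (simp add: column_def vec_eq_iff)

lemma column_map_matrix: "column n (map_matrix s A) = map_vec s (column n A)"
  by (simp add: column_def map_vec_def map_matrix_def vec_eq_iff)

lemma column_of_columns: "column n (\<chi> m n. g n $ m) = g n"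
  by (simp add: column_def vec_eq_iff)

lemma repeat_col_nth: "repeat_col v $ m $ n = v $ m"
  by (simp add: repeat_col_def matrix_matrix_mult_def columnvector_def)

lemmas column_simps = column_times column_plus column_map_matrix column_of_columns

text \<open>Since \<open>D\<close> is arbitrary, zero residuals remove the penalties without
  unfolding any weight or diagonal matrix.\<close>

lemma norm_diag_zero [simp]: "norm_diag D 0 = 0"
  by (simp add: norm_diag_def column_def norm_vec_def L2_set_def)

text \<open>Turns the Frobenius norm of the data term into a sum over samples, the form of
  \<open>J_e\<close>.\<close>

lemma norm_row_matrix_square: "(norm (A :: real^'n::finite^1))\<^sup>2 = (\<Sum>n\<in>UNIV. (A $ 1 $ n)\<^sup>2)"
  by (simp add: norm_vec_def L2_set_def sum_nonneg)

theorem theorem2p2: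
  fixes c f :: "real^'d \<Rightarrow> real" and x :: "'n::finite \<Rightarrow> real^'d" and \<sigma> :: "real \<Rightarrow> real"
    and W1 :: "real^'d^'m" and W2 :: "real^'m^'m" and W3 :: "real^'m^1"
    and b1 b2 :: "real^'m" and b3 :: real
  assumes c_continuous: "continuous_on (cball 0 1) c"
    and c_bounded_below: "\<exists>\<delta>>0. \<forall>z\<in>cball 0 1. c z > \<delta>"
    and c_partials: "\<And>i n. (\<lambda>t. c (x n + t *\<^sub>R axis i 1)) differentiable (at 0)"
    and x_in: "\<And>n. x n \<in> cball 0 1"
    and \<sigma>_differentiable: "\<And>t. \<sigma> differentiable (at t)"
    and \<sigma>_twice_differentiable: "\<And>t. deriv \<sigma> differentiable (at t)"
  shows "\<exists>(a1 :: real^'n^'m) a2 d1 d2 q.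
           J_S_e c x f \<sigma> W1 W2 W3 b1 b2 b3 a1 a2 d1 d2 q \<le> J_e c x f \<sigma> W1 W2 W3 b1 b2 b3"
proof -
  let ?l1 = "layer1 W1 b1" and ?l2 = "layer2 \<sigma> W1 W2 b1 b2"
  \<comment> \<open>Column \<open>n\<close> of each witness is the corresponding forward-pass
    quantity at \<open>x n\<close>; for \<open>d1\<close> all columns agree, because the first layer
    is affine.\<close>
  define a1 :: "real^'n^'m" where "a1 = (\<chi> m n. ?l1 (x n) $ m)"
  define a2 :: "real^'n^'m" where "a2 = (\<chi> m n. ?l2 (x n) $ m)"
  define d1 :: "'d \<Rightarrow> real^'n^'m" where "d1 i = (\<chi> m n. column i W1 $ m)" for i
  define d2 :: "'d \<Rightarrow> real^'n^'m"
    where "d2 i = (\<chi> m n. layer2_deriv \<sigma> W1 W2 b1 i (x n) $ m)" for i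
  define q :: "'d \<Rightarrow> real^'n^'m"
    where "q i = (\<chi> m n. layer2_deriv2 \<sigma> W1 W2 b1 i (x n) $ m)" for i
  note columns = a1_def a2_def d1_def d2_def q_def
  have res_a1: "W1 ** Xmat x + repeat_col b1 - a1 = 0"
    by (simp add: vec_eq_iff matrix_mult_nth repeat_col_nth columns layer1_def Xmat_def
        column_of_columns)
  have res_a2: "W2 ** map_matrix \<sigma> a1 + repeat_col b2 - a2 = 0"
    by (simp add: vec_eq_iff matrix_mult_nth repeat_col_nth columns layer2_def column_simps)
  have res_d1: "repeat_col (column i W1) - d1 i = 0" for i
    by (simp add: vec_eq_iff repeat_col_nth columns)
  have res_d2: "W2 ** (map_matrix (deriv \<sigma>) a1 * d1 i) - d2 i = 0" for i
    by (simp add: vec_eq_iff matrix_mult_nth columns layer2_deriv_def column_simps)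
  have res_q: "W2 ** (map_matrix (deriv (deriv \<sigma>)) a1 * d1 i * d1 i) - q i = 0" for i
    by (simp add: vec_eq_iff matrix_mult_nth columns layer2_deriv2_def column_simps)
  let ?R = "K_e c x * (W3 ** map_matrix \<sigma> a2 + b3 *\<^sub>R 1)
      + (\<Sum>i\<in>UNIV. Ki_e c x i * (W3 ** (map_matrix (deriv \<sigma>) a2 * d2 i)))
      + Khat_e c x * (\<Sum>i\<in>UNIV. W3 ** (map_matrix (deriv (deriv \<sigma>)) a2 * d2 i * d2 i
          + map_matrix (deriv \<sigma>) a2 * q i))
      - eval_row x f"
  \<comment> \<open>Column \<open>n\<close> of the witnesses turns the three groups of the data term
    into those of the divergence formula at \<open>x n\<close>.\<close>
  have "?R $ 1 $ n =
      divergence (\<lambda>z. c z *\<^sub>R gradient (psi_e \<sigma> W1 W2 W3 b1 b2 b3) z) (x n) - f (x n)" for n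
    unfolding divergence_flux_psi_e[OF \<sigma>_differentiable \<sigma>_twice_differentiable c_partials]
    by (simp add: columns matrix_mult_nth column_simps phi_eq_layer2 phi_deriv_def phi_deriv2_def
        K_e_def Khat_e_def Ki_e_def Xhat_def Xrow_def eval_row_def rowvector_def row_def Xmat_def)
  then have "J_S_e c x f \<sigma> W1 W2 W3 b1 b2 b3 a1 a2 d1 d2 q = J_e c x f \<sigma> W1 W2 W3 b1 b2 b3"
    unfolding J_S_e_def J_e_def Let_def res_a1 res_a2 res_d1 res_d2 res_q norm_row_matrix_square
    by simp
  then show ?thesis
    by (metis order_refl)
qed

end
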